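(* For any $n\ge 0$ the geometric realization $|[n]|$ of the partially ordered set $[n]$ is homeomorphic to the geometric realization $|\Delta_n|$ of $\Delta_n$ (the topological standard $n$-simplex). The homeomorphism is given by the map $$|[n]|\to|\Delta_n|,\qquad f\mapsto \bigl(\mu(f^{-1}(0)),\mu(f^{-1}(1)),\ldots,\mu(f^{-1}(n))\bigr),$$ with $\mu$ the standard measure on $I=[0,1]$. Moreover, this homeomorphism is compatible with the maps induced by morphisms in $\Delta$: if $\theta:[n]\to[m]$ is a morphism in $\Delta$, then the diagram $$\begin{array}{ccc} |[n]| & \longrightarrow & |\Delta_n|\\ {\scriptstyle |\theta|}\downarrow & & \downarrow{\scriptstyle \theta_*}\\ |[m]| & \longrightarrow & |\Delta_m|\end{array}$$ commutes.
   Context: For an integer $n\ge0$, $[n]$ is the ordered set $\{0<1<\cdots<n\}$; $\Delta$ is the category with objects $[n]$, $n\ge 0$, and order preserving (weakly monotone) maps as morphisms. $\Delta_n$ is the simplicial set represented by $[n]$, and the topological standard $n$-simplex is $|\Delta_n|=\{(x_0,\ldots,x_n)\in\mathbb{R}^{n+1}: x_i\ge 0,\ \sum x_i=1\}$ with the subspace topology; for $\theta:[n]\to[m]$, the map $\theta_*:|\Delta_n|\to|\Delta_m|$ is $\theta_*(t_0,\ldots,t_n)=(s_0,\ldots,s_m)$ with $s_i=\sum_{j\in\theta^{-1}(i)}t_j$. Geometric realization of a finite partially ordered set $P$: consider $P$ as a metric space by the discrete metric $d(x,y)=1-\delta_{xy}$. Then $|P|$ is the set of all order preserving upper semi-continuous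 maps $f:I=[0,1]\to P$ (for order preserving $f$, whose image is a finite chain, upper semi-continuity means that $\{t\in I: f(t)\ge p\}$ is closed for every $p$ in the image of $f$), given the structure of a metric space by the metric $d(f,g)=\int_0^1 d(f(t),g(t))\,dt$. For an order preserving map $\theta:P\to Q$, $|\theta|:|P|\to|Q|$ is $f\mapsto\theta\circ f$.
   Formalization: In |P|, maps at distance 0 (those that differ only at t=1) are identified: as written d is not a metric and the map is not injective, since for P=[1] the constant map 0 and the map equal to 0 on [0,1) and 1 at t=1 both go to (1,0). *)

theory Defs
  imports "HOL-Analysis.Analysis" "HOL-Homology.Simplices"
begin

section \<open>Geometric realization of a finite partially ordered set\<close>

text \<open>A finite partially ordered set is a finite set \<^term>\<open>P\<close> of elements of a type of class
  \<^class>\<open>order\<close>; the ordered set \<open>[n]\<close> is \<^term>\<open>{..n::nat}\<close>.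
  Maps defined on \<open>I = [0,1]\<close> are extensional, so that equality of maps is equality on \<open>I\<close>.\<close>

definition usc_maps :: "'a::order set \<Rightarrow> (real \<Rightarrow> 'a) set" where
  "usc_maps P = {f \<in> {0..1} \<rightarrow>\<^sub>E P. mono_on {0..1} f \<and>
                    (\<forall>p \<in> f ` {0..1}. closed {t \<in> {0..1}. p \<le> f t})}"

definition maps_dist :: "(real \<Rightarrow> 'a) \<Rightarrow> (real \<Rightarrow> 'a) \<Rightarrow> real" where
  "maps_dist f g = (LBINT t:{0..1}. discrete_metric.dd (f t) (g t))"

text \<open>On \<^term>\<open>usc_maps P\<close> the distance \<^const>\<open>maps_dist\<close> is only a pseudometric: a map may jump at
  the single point \<open>1\<close> (see \<open>maps_dist_not_separated\<close> below). The metric space \<open>|P|\<close> is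
  therefore the associated metric space, in which maps at distance \<open>0\<close> are identified.
  Operations on classes are given by representatives; they do not depend on the choice
  (\<open>realization_dist_class\<close>, \<open>realization_map_class\<close>, \<open>comparison_map_class\<close>).\<close>

definition usc_maps_rel :: "'a::order set \<Rightarrow> ((real \<Rightarrow> 'a) \<times> (real \<Rightarrow> 'a)) set" where
  "usc_maps_rel P = {(f, g). f \<in> usc_maps P \<and> g \<in> usc_maps P \<and> maps_dist f g = 0}"

definition realization :: "'a::order set \<Rightarrow> (real \<Rightarrow> 'a) set set" where
  "realization P = usc_maps P // usc_maps_rel P"

definition rep :: "'b set \<Rightarrow> 'b" where
  "rep x = (SOME f. f \<in> x)"

definition realization_dist :: "(real \<Rightarrow> 'a) set \<Rightarrow> (real \<Rightarrow> 'a) set \<Rightarrow> real" where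
  "realization_dist x y = maps_dist (rep x) (rep y)"

definition realization_topology :: "'a::order set \<Rightarrow> (real \<Rightarrow> 'a) set topology" where
  "realization_topology P = Metric_space.mtopology (realization P) realization_dist"

text \<open>The map \<open>|\<theta>| : |P| \<rightarrow> |Q|\<close>; the target \<^term>\<open>Q\<close> is needed to form the class.\<close>

definition realization_map ::
  "'b::order set \<Rightarrow> ('a::order \<Rightarrow> 'b) \<Rightarrow> (real \<Rightarrow> 'a) set \<Rightarrow> (real \<Rightarrow> 'b) set" where
  "realization_map Q \<theta> x = usc_maps_rel Q `` {compose {0..1} \<theta> (rep x)}"


section \<open>The topological standard simplex\<close>

text \<open>In the library, \<open>\<real>\<^sup>n\<^sup>+\<^sup>1\<close> is \<^term>\<open>Euclidean_space (Suc n)\<close>: sequences vanishing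
  from index \<open>n+1\<close> on.\<close>

definition simplex_topology :: "nat \<Rightarrow> (nat \<Rightarrow> real) topology" where
  "simplex_topology n = subtopology (Euclidean_space (Suc n)) (standard_simplex n)"

definition std_simplex_map :: "nat \<Rightarrow> (nat \<Rightarrow> nat) \<Rightarrow> (nat \<Rightarrow> real) \<Rightarrow> (nat \<Rightarrow> real)" where
  "std_simplex_map n \<theta> t = (\<lambda>i. \<Sum>j \<in> {..n} \<inter> \<theta> -` {i}. t j)"


section \<open>The comparison map\<close>

text \<open>For a map into \<open>[n]\<close> the coordinates with index above \<open>n\<close> are \<open>0\<close>, as required of points
  of the simplex.\<close>

definition fibre_measures :: "(real \<Rightarrow> nat) \<Rightarrow> (nat \<Rightarrow> real)" where
  "fibre_measures f = (\<lambda>i. measure lborel (f -` {i} \<inter> {0..1}))"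

definition comparison_map :: "(real \<Rightarrow> nat) set \<Rightarrow> (nat \<Rightarrow> real)" where
  "comparison_map x = fibre_measures (rep x)"


section \<open>Well-definedness\<close>

lemma usc_maps_fibre_borel:
  assumes "f \<in> usc_maps P"
  shows "f -` {p} \<inter> {0..1} \<in> sets lborel"
proof -
  have "is_interval (f -` {p} \<inter> {0..1})"
    unfolding is_interval_1
  proof (intro ballI allI impI)
    fix a b x assume a: "a \<in> f -` {p} \<inter> {0..1}" and b: "b \<in> f -` {p} \<inter> {0..1}" and x: "a \<le> x \<and> x \<le> b"
    have m: "mono_on {0..1} f" using assms by (simp add: usc_maps_def)
    have "f a \<le> f x" "f x \<le> f b" by (rule mono_onD[OF m]; use a b x in force)+
    moreover have "f a = p" "f b = p" "x \<in> {0..1}" using a b x by auto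
    ultimately show "x \<in> f -` {p} \<inter> {0..1}" by (auto intro: order_antisym)
  qed
  then show ?thesis using real_interval_borel_measurable by auto
qed

lemma usc_maps_diff_borel:
  assumes "finite P" "f \<in> usc_maps P" "g \<in> usc_maps P"
  shows "{t \<in> {0..1}. f t \<noteq> g t} \<in> sets lborel"
proof -
  have fP: "f t \<in> P" if "t \<in> {0..1}" for t
    using assms(2) that by (auto simp only: usc_maps_def mem_Collect_eq dest: PiE_mem)
  have "{t \<in> {0..1}. f t \<noteq> g t} =
        {0..1} - (\<Union>p\<in>P. (f -` {p} \<inter> {0..1}) \<inter> (g -` {p} \<inter> {0..1}))" (is "?L = ?R")
  proof (rule Set.set_eqI)
    show "t \<in> ?L \<longleftrightarrow> t \<in> ?R" for t
      using fP[of t] by (cases "t \<in> {0..1}") (auto simp del: atLeastAtMost_iff)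
  qed
  moreover have "(\<Union>p\<in>P. (f -` {p} \<inter> {0..1}) \<inter> (g -` {p} \<inter> {0..1})) \<in> sets lborel"
    by (intro sets.finite_UN sets.Int usc_maps_fibre_borel[OF assms(2)]
        usc_maps_fibre_borel[OF assms(3)] assms(1))
  moreover have "{0..1::real} \<in> sets lborel" by simp
  ultimately show ?thesis by (simp only: sets.Diff)
qed

lemma maps_dist_eq_measure:
  assumes "finite P" "f \<in> usc_maps P" "g \<in> usc_maps P"
  shows "maps_dist f g = measure lborel {t \<in> {0..1}. f t \<noteq> g t}"
proof -
  have "maps_dist f g = (LBINT t. indicator {t \<in> {0..1}. f t \<noteq> g t} t)"
    unfolding maps_dist_def set_lebesgue_integral_def discrete_metric.dd_def
    by (rule Bochner_Integration.integral_cong) (auto simp: indicator_def)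
  then show ?thesis using usc_maps_diff_borel[OF assms] by simp
qed

lemma maps_dist_nonneg: "0 \<le> maps_dist f g"
  unfolding maps_dist_def set_lebesgue_integral_def discrete_metric.dd_def
  by (rule Bochner_Integration.integral_nonneg) auto

lemma maps_dist_commute: "maps_dist f g = maps_dist g f"
  unfolding maps_dist_def set_lebesgue_integral_def discrete_metric.dd_def
  by (rule Bochner_Integration.integral_cong) auto

lemma maps_dist_refl: "maps_dist f f = 0"
  by (simp add: maps_dist_def discrete_metric.dd_def set_lebesgue_integral_def)

lemma fmeasurable_diff:
  assumes "finite P" "f \<in> usc_maps P" "g \<in> usc_maps P"
  shows "{t \<in> {0..1::real}. f t \<noteq> g t} \<in> fmeasurable lborel"
  by (rule fmeasurableI2[OF _ _ usc_maps_diff_borel[OF assms], of "{0..1}"])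
     (auto simp: fmeasurable_def)

lemma maps_dist_triangle:
  assumes "finite P" "f \<in> usc_maps P" "g \<in> usc_maps P" "h \<in> usc_maps P"
  shows "maps_dist f h \<le> maps_dist f g + maps_dist g h"
proof -
  let ?A = "{t \<in> {0..1}. f t \<noteq> g t}" and ?B = "{t \<in> {0..1}. g t \<noteq> h t}"
  note A = fmeasurable_diff[OF assms(1-3)] and B = fmeasurable_diff[OF assms(1,3,4)]
  have "measure lborel {t \<in> {0..1}. f t \<noteq> h t} \<le> measure lborel (?A \<union> ?B)"
  proof (rule measure_mono_fmeasurable)
    show "{t \<in> {0..1}. f t \<noteq> h t} \<subseteq> ?A \<union> ?B" by (rule subsetI) (simp, metis)
    show "{t \<in> {0..1}. f t \<noteq> h t} \<in> sets lborel" by (rule usc_maps_diff_borel[OF assms(1,2,4)])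
    show "?A \<union> ?B \<in> fmeasurable lborel" using A B by (rule fmeasurable.Un)
  qed
  also have "\<dots> \<le> measure lborel ?A + measure lborel ?B"
    using A B by (intro measure_Un_le fmeasurableD)
  finally show ?thesis
    unfolding maps_dist_eq_measure[OF assms(1,2,4)] maps_dist_eq_measure[OF assms(1-3)]
      maps_dist_eq_measure[OF assms(1,3,4)] .
qed

lemma maps_dist_not_separated:
  fixes f g :: "real \<Rightarrow> nat"
  defines "f \<equiv> \<lambda>t\<in>{0..1}. 0" and "g \<equiv> \<lambda>t\<in>{0..1}. if t = 1 then 1 else 0"
  shows "f \<in> usc_maps {..1}" "g \<in> usc_maps {..1}" "f \<noteq> g" "maps_dist f g = 0"
proof -
  have "{t \<in> {0..1}. p \<le> f t} = (if p = 0 then {0..1} else {})" for p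
    by (auto simp: f_def)
  then have "closed {t \<in> {0..1}. p \<le> f t}" for p by simp
  then show f: "f \<in> usc_maps {..1}"
    unfolding usc_maps_def by (auto simp: f_def mono_on_def simp del: atLeastAtMost_iff)
  have "{t \<in> {0..1}. p \<le> g t} = (if p = 0 then {0..1} else if p = 1 then {1} else {})" for p
    by (auto simp: g_def split: if_splits)
  then have "closed {t \<in> {0..1}. p \<le> g t}" for p by simp
  moreover have "mono_on {0..1} g" by (auto simp: g_def mono_on_def)
  moreover have "g \<in> {0..1} \<rightarrow>\<^sub>E {..1}" by (auto simp: g_def)
  ultimately show g: "g \<in> usc_maps {..1}" by (simp add: usc_maps_def)
  have "f 1 \<noteq> g 1" by (simp add: f_def g_def)
  then show "f \<noteq> g" by metis
  have "{t \<in> {0..1}. f t \<noteq> g t} = {1}" by (auto simp: f_def g_def)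
  then show "maps_dist f g = 0"
    using maps_dist_eq_measure[OF _ f g] by simp
qed

lemma equiv_usc_maps_rel:
  assumes "finite P"
  shows "equiv (usc_maps P) (usc_maps_rel P)"
proof (rule equivI)
  show "refl_on (usc_maps P) (usc_maps_rel P)"
    by (auto simp: refl_on_def usc_maps_rel_def maps_dist_refl)
  show "usc_maps_rel P \<subseteq> usc_maps P \<times> usc_maps P"
    by (auto simp: usc_maps_rel_def)
  show "sym (usc_maps_rel P)"
    by (auto simp: sym_def usc_maps_rel_def maps_dist_commute)
  show "trans (usc_maps_rel P)"
  proof (rule transI)
    fix f g h assume "(f, g) \<in> usc_maps_rel P" "(g, h) \<in> usc_maps_rel P"
    then show "(f, h) \<in> usc_maps_rel P"
      using maps_dist_triangle[OF assms, of f g h] maps_dist_nonneg[of f h]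
      by (auto simp: usc_maps_rel_def)
  qed
qed

lemma rep_class:
  assumes "finite P" "f \<in> usc_maps P"
  shows "(f, rep (usc_maps_rel P `` {f})) \<in> usc_maps_rel P"
proof -
  have "f \<in> usc_maps_rel P `` {f}"
    using assms by (simp add: usc_maps_rel_def maps_dist_refl)
  then have "rep (usc_maps_rel P `` {f}) \<in> usc_maps_rel P `` {f}"
    unfolding rep_def by (rule someI[where P = "\<lambda>h. h \<in> usc_maps_rel P `` {f}"])
  then show ?thesis by simp
qed

lemma realization_dist_class:
  assumes "finite P" "f \<in> usc_maps P" "g \<in> usc_maps P"
  shows "realization_dist (usc_maps_rel P `` {f}) (usc_maps_rel P `` {g}) = maps_dist f g"
proof -
  define f' where "f' = rep (usc_maps_rel P `` {f})"
  define g' where "g' = rep (usc_maps_rel P `` {g})"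
  have f': "f' \<in> usc_maps P" "maps_dist f f' = 0" and g': "g' \<in> usc_maps P" "maps_dist g g' = 0"
    using rep_class[of P f] rep_class[of P g] assms
    by (auto simp: usc_maps_rel_def f'_def g'_def)
  have "maps_dist f' g' = maps_dist f g"
    using maps_dist_triangle[of P f' f g'] maps_dist_triangle[of P f g g']
      maps_dist_triangle[of P f f' g] maps_dist_triangle[of P f' g' g]
      assms f' g' maps_dist_commute[of f f'] maps_dist_commute[of g g'] by linarith
  then show ?thesis by (simp add: realization_dist_def f'_def g'_def)
qed

lemma realizationE:
  assumes "x \<in> realization P"
  obtains f where "f \<in> usc_maps P" "x = usc_maps_rel P `` {f}"
  using assms unfolding realization_def by (rule quotientE) (rule that)

lemma Metric_space_realization:
  assumes "finite P"
  shows "Metric_space (realization P) realization_dist"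
proof
  show "0 \<le> realization_dist x y" for x y :: "(real \<Rightarrow> 'a) set"
    by (simp add: realization_dist_def maps_dist_nonneg)
  show "realization_dist x y = realization_dist y x" for x y :: "(real \<Rightarrow> 'a) set"
    by (simp add: realization_dist_def maps_dist_commute)
next
  fix x y assume "x \<in> realization P" "y \<in> realization P"
  then obtain f g where fg: "f \<in> usc_maps P" "x = usc_maps_rel P `` {f}"
      "g \<in> usc_maps P" "y = usc_maps_rel P `` {g}"
    by (elim realizationE)
  have "x = y \<longleftrightarrow> maps_dist f g = 0"
    unfolding fg(2,4) eq_equiv_class_iff[OF equiv_usc_maps_rel[OF assms] fg(1,3)]
    using fg by (simp add: usc_maps_rel_def)
  then show "realization_dist x y = 0 \<longleftrightarrow> x = y"
    using fg by (simp add: realization_dist_class[OF assms])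
next
  fix x y z assume "x \<in> realization P" "y \<in> realization P" "z \<in> realization P"
  then obtain f g h where fgh: "f \<in> usc_maps P" "x = usc_maps_rel P `` {f}"
      "g \<in> usc_maps P" "y = usc_maps_rel P `` {g}"
      "h \<in> usc_maps P" "z = usc_maps_rel P `` {h}"
    by (elim realizationE)
  then show "realization_dist x z \<le> realization_dist x y + realization_dist y z"
    by (simp add: realization_dist_class[OF assms] maps_dist_triangle[OF assms fgh(1,3,5)])
qed

lemma compose_usc_maps:
  assumes "finite P" "f \<in> usc_maps P" "\<theta> \<in> P \<rightarrow> Q" "mono_on P \<theta>"
  shows "compose {0..1} \<theta> f \<in> usc_maps Q"
proof -
  have f: "f \<in> {0..1} \<rightarrow>\<^sub>E P" and mf: "mono_on {0..1} f"
    and cf: "\<And>p. p \<in> f ` {0..1} \<Longrightarrow> closed {t \<in> {0..1}. p \<le> f t}"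
    using assms by (auto simp: usc_maps_def)
  have fP: "f t \<in> P" if "t \<in> {0..1}" for t using f that by (rule PiE_mem)
  have "mono_on {0..1} (compose {0..1} \<theta> f)"
  proof (rule mono_onI)
    fix r s :: real assume rs: "r \<in> {0..1}" "s \<in> {0..1}" "r \<le> s"
    then have "f r \<le> f s" by (intro mono_onD[OF mf])
    then have "\<theta> (f r) \<le> \<theta> (f s)" using rs fP by (intro mono_onD[OF assms(4)])
    then show "compose {0..1} \<theta> f r \<le> compose {0..1} \<theta> f s" using rs by (simp add: compose_eq)
  qed
  moreover have "closed {t \<in> {0..1}. q \<le> compose {0..1} \<theta> f t}" for q
  proof -
    define A where "A = {p \<in> f ` {0..1}. q \<le> \<theta> p}"
    have "finite A" unfolding A_def
      by (rule finite_subset[OF _ assms(1)]) (use fP in auto)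
    moreover have "{t \<in> {0..1}. q \<le> compose {0..1} \<theta> f t} = (\<Union>p\<in>A. {t \<in> {0..1}. p \<le> f t})"
    proof (intro Set.set_eqI iffI)
      fix t assume "t \<in> {t \<in> {0..1}. q \<le> compose {0..1} \<theta> f t}"
      then show "t \<in> (\<Union>p\<in>A. {t \<in> {0..1}. p \<le> f t})"
        by (auto simp: A_def compose_def)
    next
      fix t assume "t \<in> (\<Union>p\<in>A. {t \<in> {0..1}. p \<le> f t})"
      then obtain s where s: "s \<in> {0..1}" "q \<le> \<theta> (f s)" "f s \<le> f t" "t \<in> {0..1}"
        by (auto simp: A_def)
      have "\<theta> (f s) \<le> \<theta> (f t)" using s fP by (intro mono_onD[OF assms(4)])
      then have "q \<le> \<theta> (f t)" using s order_trans by blast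
      then show "t \<in> {t \<in> {0..1}. q \<le> compose {0..1} \<theta> f t}"
        using s by (simp add: compose_eq)
    qed
    ultimately show ?thesis using cf by (auto simp: A_def intro!: closed_UN)
  qed
  moreover have "compose {0..1} \<theta> f \<in> {0..1} \<rightarrow>\<^sub>E Q"
    using fP assms(3) by (auto simp: compose_def)
  ultimately show ?thesis by (simp add: usc_maps_def)
qed

lemma realization_map_class:
  assumes "finite P" "finite Q" "\<theta> \<in> P \<rightarrow> Q" "mono_on P \<theta>" "f \<in> usc_maps P"
  shows "realization_map Q \<theta> (usc_maps_rel P `` {f}) = usc_maps_rel Q `` {compose {0..1} \<theta> f}"
    and "realization_map Q \<theta> (usc_maps_rel P `` {f}) \<in> realization Q"
proof -
  define f' where "f' = rep (usc_maps_rel P `` {f})"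
  have f': "f' \<in> usc_maps P" "maps_dist f f' = 0"
    using rep_class[of P f] assms by (auto simp: usc_maps_rel_def f'_def)
  let ?h = "compose {0..1} \<theta> f" and ?h' = "compose {0..1} \<theta> f'"
  have h: "?h \<in> usc_maps Q" "?h' \<in> usc_maps Q"
    by (rule compose_usc_maps[OF assms(1) _ assms(3,4)]; rule assms f')+
  have "measure lborel {t \<in> {0..1}. ?h t \<noteq> ?h' t} \<le> measure lborel {t \<in> {0..1}. f t \<noteq> f' t}"
  proof (rule measure_mono_fmeasurable)
    show "{t \<in> {0..1}. ?h t \<noteq> ?h' t} \<subseteq> {t \<in> {0..1}. f t \<noteq> f' t}"
      by (auto simp: compose_def)
    show "{t \<in> {0..1}. ?h t \<noteq> ?h' t} \<in> sets lborel" by (rule usc_maps_diff_borel[OF assms(2) h])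
    show "{t \<in> {0..1}. f t \<noteq> f' t} \<in> fmeasurable lborel"
      by (rule fmeasurable_diff[OF assms(1,5) f'(1)])
  qed
  then have "maps_dist ?h ?h' \<le> maps_dist f f'"
    unfolding maps_dist_eq_measure[OF assms(2) h] maps_dist_eq_measure[OF assms(1,5) f'(1)] .
  then have "maps_dist ?h ?h' = 0"
    using f'(2) maps_dist_nonneg[of ?h ?h'] by linarith
  then have "(?h', ?h) \<in> usc_maps_rel Q"
    using h by (simp add: usc_maps_rel_def maps_dist_commute)
  then show 1: "realization_map Q \<theta> (usc_maps_rel P `` {f}) = usc_maps_rel Q `` {?h}"
    unfolding realization_map_def f'_def[symmetric]
    by (rule equiv_class_eq[OF equiv_usc_maps_rel[OF assms(2)]])
  show "realization_map Q \<theta> (usc_maps_rel P `` {f}) \<in> realization Q"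
    unfolding 1 realization_def using h by (simp add: quotientI)
qed

lemma comparison_map_class:
  assumes "finite P" "f \<in> usc_maps P"
  shows "comparison_map (usc_maps_rel P `` {f}) = fibre_measures f"
proof
  fix i
  define f' where "f' = rep (usc_maps_rel P `` {f})"
  have f': "f' \<in> usc_maps P" "maps_dist f f' = 0"
    using rep_class[of P f] assms by (auto simp: usc_maps_rel_def f'_def)
  let ?D = "{t \<in> {0..1}. f t \<noteq> f' t}"
  have D: "?D \<in> fmeasurable lborel" by (rule fmeasurable_diff[OF assms f'(1)])
  have "measure lborel ?D = 0"
    using f'(2) maps_dist_eq_measure[OF assms f'(1)] by metis
  then have "?D \<in> null_sets lborel"
    using D by (metis emeasure_eq_measure2 ennreal_0 fmeasurableD null_setsI)
  then have "AE t in lborel. t \<notin> ?D" by (rule AE_not_in)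
  then have "AE t in lborel. t \<in> f' -` {i} \<inter> {0..1} \<longleftrightarrow> t \<in> f -` {i} \<inter> {0..1}"
    by (rule AE_mp) auto
  then have "measure lborel (f' -` {i} \<inter> {0..1}) = measure lborel (f -` {i} \<inter> {0..1})"
    using usc_maps_fibre_borel f'(1) assms(2) by (intro measure_eq_AE) auto
  then show "comparison_map (usc_maps_rel P `` {f}) i = fibre_measures f i"
    by (simp add: comparison_map_def fibre_measures_def f'_def)
qed

lemma topspace_realization_topology:
  assumes "finite P"
  shows "topspace (realization_topology P) = realization P"
  unfolding realization_topology_def
  by (rule Metric_space.topspace_mtopology[OF Metric_space_realization[OF assms]])

lemma topspace_simplex_topology: "topspace (simplex_topology n) = standard_simplex n"
  by (auto simp: simplex_topology_def topspace_Euclidean_space standard_simplex_def)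

lemma std_simplex_map_in_standard_simplex:
  assumes "\<theta> \<in> {..n} \<rightarrow> {..m}" "t \<in> standard_simplex n"
  shows "std_simplex_map n \<theta> t \<in> standard_simplex m"
proof -
  have nn: "0 \<le> t j" for j using assms(2) by (simp add: standard_simplex_def)
  have s1: "(\<Sum>j\<le>n. t j) = 1" using assms(2) by (simp add: standard_simplex_def)
  have "(\<Sum>i\<le>m. \<Sum>j \<in> {..n} \<inter> \<theta> -` {i}. t j) = (\<Sum>i\<le>m. \<Sum>j \<in> {j \<in> {..n}. \<theta> j = i}. t j)"
    by (intro sum.cong) auto
  also have "\<dots> = (\<Sum>j\<le>n. t j)" using assms(1) by (intro sum.group) auto
  finally have "(\<Sum>i\<le>m. std_simplex_map n \<theta> t i) = 1" using s1 by (simp add: std_simplex_map_def)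
  moreover have "0 \<le> std_simplex_map n \<theta> t i" for i
    unfolding std_simplex_map_def by (rule sum_nonneg) (rule nn)
  moreover have "std_simplex_map n \<theta> t i \<le> 1" for i
    unfolding std_simplex_map_def s1[symmetric] by (rule sum_mono2) (auto simp: nn)
  moreover have "std_simplex_map n \<theta> t i = 0" if "i > m" for i
  proof -
    have "{..n} \<inter> \<theta> -` {i} = {}" using assms(1) that by (auto simp: Pi_iff not_le[symmetric])
    then show ?thesis by (simp add: std_simplex_map_def)
  qed
  ultimately show ?thesis by (auto simp: standard_simplex_def)
qed

end

theory Submission
  imports Defs
begin

text \<open>An order preserving map \<open>f : I \<rightarrow> [n]\<close> is determined, up to finitely many points, by the lengths
  of its initial segments \<open>{f < k}\<close>, which are the partial sums of the fibre measures. Initial segments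
  are nested, so their symmetric differences have measure the difference of the lengths; hence
  \<open>d(f, g)\<close> is at most the sum over \<open>k\<close> of the distances of the partial sums. This gives injectivity and
  continuity of the inverse, while each fibre measure is 1-Lipschitz in \<open>f\<close>. A point \<open>x\<close> of the simplex
  is hit by the map sending \<open>t\<close> to the largest \<open>k \<le> n\<close> with \<open>x\<^sub>0 + \<dots> + x\<^sub>k\<^sub>-\<^sub>1 \<le> t\<close>.\<close>

section \<open>Measures of preimages and fibre measures\<close>

lemma usc_maps_in:
  assumes "f \<in> usc_maps P" "t \<in> {0..1}"
  shows "f t \<in> P"
  using assms by (auto simp only: usc_maps_def mem_Collect_eq dest: PiE_mem)

text \<open>The preimage is a finite disjoint union of fibres, so it has finite measure and
  additivity applies.\<close>

lemma usc_maps_preimage: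
  assumes "finite P" "f \<in> usc_maps P"
  shows "f -` A \<inter> {0..1} \<in> fmeasurable lborel"
    and "measure lborel (f -` A \<inter> {0..1}) = (\<Sum>p \<in> P \<inter> A. measure lborel (f -` {p} \<inter> {0..1}))"
proof -
  have eq: "f -` A \<inter> {0..1} = (\<Union>p \<in> P \<inter> A. f -` {p} \<inter> {0..1})"
    using usc_maps_in[OF assms(2)] by blast
  have fm: "f -` {p} \<inter> {0..1} \<in> fmeasurable lborel" for p
    by (rule fmeasurableI2[OF _ _ usc_maps_fibre_borel[OF assms(2)], of "{0..1}"])
       (auto simp: fmeasurable_def)
  show "f -` A \<inter> {0..1} \<in> fmeasurable lborel"
    unfolding eq using assms(1) fm by (intro fmeasurable.finite_UN) auto
  show "measure lborel (f -` A \<inter> {0..1}) = (\<Sum>p \<in> P \<inter> A. measure lborel (f -` {p} \<inter> {0..1}))"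
    unfolding eq
  proof (rule measure_UNION')
    show "finite (P \<inter> A)" using assms(1) by simp
    show "f -` {p} \<inter> {0..1} \<in> fmeasurable lborel" for p by (rule fm)
    show "pairwise (\<lambda>p q. disjnt (f -` {p} \<inter> {0..1}) (f -` {q} \<inter> {0..1})) (P \<inter> A)"
      by (auto simp: pairwise_def disjnt_def)
  qed
qed

text \<open>The choice of \<open>A\<close> yields the basic facts about fibre measures:
  \<open>UNIV\<close> gives total mass 1, initial segments give the partial sums, and fibres of
  \<open>\<theta>\<close> give naturality.\<close>

lemma measure_usc_maps_preimage:
  fixes f :: "real \<Rightarrow> nat"
  assumes "f \<in> usc_maps {..n}"
  shows "measure lborel (f -` A \<inter> {0..1}) = (\<Sum>j \<in> {..n} \<inter> A. fibre_measures f j)"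
  unfolding fibre_measures_def using assms by (intro usc_maps_preimage) auto

lemma fibre_measures_compose:
  assumes "f \<in> usc_maps {..n}"
  shows "fibre_measures (compose {0..1} \<theta> f) = std_simplex_map n \<theta> (fibre_measures f)"
proof
  fix i
  have "compose {0..1} \<theta> f -` {i} \<inter> {0..1} = f -` (\<theta> -` {i}) \<inter> {0..1}"
    by (auto simp: compose_def)
  then show "fibre_measures (compose {0..1} \<theta> f) i = std_simplex_map n \<theta> (fibre_measures f) i"
    using measure_usc_maps_preimage[OF assms, of "\<theta> -` {i}"]
    by (simp add: fibre_measures_def std_simplex_map_def)
qed

lemma fibre_measures_in_simplex:
  assumes "f \<in> usc_maps {..n}"
  shows "fibre_measures f \<in> standard_simplex n"
proof -
  have nn: "0 \<le> fibre_measures f i" for i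
    by (simp add: fibre_measures_def)
  have s: "(\<Sum>j\<le>n. fibre_measures f j) = 1"
    using measure_usc_maps_preimage[OF assms, of UNIV] by simp
  have z: "fibre_measures f i = 0" if "i > n" for i
    \<comment> \<open>Here \<open>{..n} \<inter> {i}\<close> is empty, so the sum is 0.\<close>
    using measure_usc_maps_preimage[OF assms, of "{i}"] that by (simp add: fibre_measures_def)
  have "fibre_measures f i \<le> 1" for i
    using member_le_sum[of i "{..n}" "fibre_measures f"] nn s z[of i] by (cases "i \<le> n") auto
  then show ?thesis using nn s z by (simp add: standard_simplex_def)
qed

text \<open>The fibre of \<open>f\<close> over \<open>i\<close> is covered by that of
  \<open>g\<close> together with the set where the maps differ, whose measure is
  \<open>maps_dist f g\<close>; then the roles of \<open>f\<close> and \<open>g\<close> are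
  exchanged.\<close>

lemma fibre_measures_Lipschitz:
  assumes "f \<in> usc_maps {..n}" "g \<in> usc_maps {..n}"
  shows "\<bar>fibre_measures f i - fibre_measures g i\<bar> \<le> maps_dist f g"
proof -
  have le: "fibre_measures f i \<le> fibre_measures g i + maps_dist f g"
    if fg: "f \<in> usc_maps {..n}" "g \<in> usc_maps {..n}" for f g
  proof -
    let ?G = "g -` {i} \<inter> {0..1}" and ?D = "{t \<in> {0..1}. f t \<noteq> g t}"
    have m: "?G \<in> fmeasurable lborel" "?D \<in> fmeasurable lborel"
      using usc_maps_preimage(1)[of "{..n}" g] fmeasurable_diff[of "{..n}" f g] fg by auto
    have "fibre_measures f i \<le> measure lborel (?G \<union> ?D)"
      unfolding fibre_measures_def
    proof (rule measure_mono_fmeasurable)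
      show "f -` {i} \<inter> {0..1} \<subseteq> ?G \<union> ?D" by auto
      show "f -` {i} \<inter> {0..1} \<in> sets lborel" by (rule usc_maps_fibre_borel[OF fg(1)])
      show "?G \<union> ?D \<in> fmeasurable lborel" using m by (rule fmeasurable.Un)
    qed
    also have "\<dots> \<le> measure lborel ?G + measure lborel ?D"
      using m by (intro measure_Un_le fmeasurableD)
    finally show ?thesis
      using fg by (simp add: fibre_measures_def maps_dist_eq_measure[of "{..n}"])
  qed
  show ?thesis
    using le[OF assms] le[OF assms(2,1)] maps_dist_commute[of f g] by linarith
qed

section \<open>Bounding the distance by partial sums\<close>

definition partial_sum_dist :: "nat \<Rightarrow> (nat \<Rightarrow> real) \<Rightarrow> (nat \<Rightarrow> real) \<Rightarrow> real" where
  "partial_sum_dist n x y = (\<Sum>k\<le>n. \<bar>(\<Sum>i<k. x i) - (\<Sum>i<k. y i)\<bar>)"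

lemma measure_initial_segment:
  assumes "f \<in> usc_maps {..n}" "k \<le> n"
  shows "measure lborel (f -` {..<k} \<inter> {0..1}) = (\<Sum>i<k. fibre_measures f i)"
proof -
  have "{..n} \<inter> {..<k} = {..<k}" using assms(2) by auto
  then show ?thesis using measure_usc_maps_preimage[OF assms(1), of "{..<k}"] by simp
qed

text \<open>Nesting makes one of the two set differences empty, and the other has measure equal to
  the gap between the two measures.\<close>

lemma measure_sym_diff_nested:
  assumes "A \<in> fmeasurable M" "B \<in> fmeasurable M" "A \<subseteq> B \<or> B \<subseteq> A"
  shows "measure M (sym_diff A B) = \<bar>measure M A - measure M B\<bar>"
  using assms(3)
proof
  assume "A \<subseteq> B"
  then show ?thesis
    using measurable_measure_Diff[OF assms(2) fmeasurableD[OF assms(1)]]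
      measure_mono_fmeasurable[of A B M] assms by (simp add: Diff_eq_empty_iff[THEN iffD2])
next
  assume "B \<subseteq> A"
  then show ?thesis
    using measurable_measure_Diff[OF assms(1) fmeasurableD[OF assms(2)]]
      measure_mono_fmeasurable[of B A M] assms by (simp add: Diff_eq_empty_iff[THEN iffD2])
qed

text \<open>Two distinct values are separated by some threshold \<open>k\<close>, so the set where
  the maps differ is covered by the symmetric differences of the initial segments below
  \<open>k\<close>.\<close>

lemma maps_dist_le_partial_sum_dist:
  assumes "f \<in> usc_maps {..n}" "g \<in> usc_maps {..n}"
  shows "maps_dist f g \<le> partial_sum_dist n (fibre_measures f) (fibre_measures g)"
proof -
  define F where "F = (\<lambda>k. f -` {..<k} \<inter> {0..1})"
  define G where "G = (\<lambda>k. g -` {..<k} \<inter> {0..1})"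
  have fm: "F k \<in> fmeasurable lborel" "G k \<in> fmeasurable lborel" for k
    using usc_maps_preimage(1)[of "{..n}"] assms by (auto simp: F_def G_def)
  have sd: "sym_diff (F k) (G k) \<in> fmeasurable lborel" for k
    using fm by (intro fmeasurable.Un fmeasurable_Diff fmeasurableD)
  \<comment> \<open>Both sets are initial segments of the interval. Points \<open>s\<close> and
    \<open>t\<close> witnessing failure of both inclusions contradict monotonicity of
    \<open>g\<close> if \<open>s \<le> t\<close>, and of \<open>f\<close> if
    \<open>t \<le> s\<close>.\<close>
  have nested: "F k \<subseteq> G k \<or> G k \<subseteq> F k" for k
  proof (rule ccontr)
    assume "\<not> (F k \<subseteq> G k \<or> G k \<subseteq> F k)"
    then obtain s t where "s \<in> F k" "s \<notin> G k" "t \<in> G k" "t \<notin> F k" by blast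
    then have st: "s \<in> {0..1}" "t \<in> {0..1}" "f s < k" "\<not> g s < k" "g t < k" "\<not> f t < k"
      by (auto simp: F_def G_def)
    have "mono_on {0..1} f" "mono_on {0..1} g" using assms by (auto simp: usc_maps_def)
    then have "s \<le> t \<Longrightarrow> g s \<le> g t" "t \<le> s \<Longrightarrow> f t \<le> f s"
      using st(1,2) by (auto intro: mono_onD)
    then show False using st by linarith
  qed
  have "maps_dist f g = measure lborel {t \<in> {0..1}. f t \<noteq> g t}"
    using assms by (intro maps_dist_eq_measure) auto
  also have "\<dots> \<le> measure lborel (\<Union>k\<le>n. sym_diff (F k) (G k))"
  proof (rule measure_mono_fmeasurable)
    show "{t \<in> {0..1}. f t \<noteq> g t} \<subseteq> (\<Union>k\<le>n. sym_diff (F k) (G k))"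
    proof
      fix t assume "t \<in> {t \<in> {0..1}. f t \<noteq> g t}"
      then have t: "t \<in> {0..1}" "f t \<noteq> g t" by auto
      then have "f t \<le> n" "g t \<le> n" using usc_maps_in assms by blast+
      then show "t \<in> (\<Union>k\<le>n. sym_diff (F k) (G k))"
        \<comment> \<open>With the larger value as threshold, exactly one of the two values lies
          strictly below it.\<close>
        using t by (intro UN_I[of "max (f t) (g t)"]) (auto simp: F_def G_def)
    qed
    show "{t \<in> {0..1}. f t \<noteq> g t} \<in> sets lborel"
      using assms by (intro usc_maps_diff_borel) auto
    show "(\<Union>k\<le>n. sym_diff (F k) (G k)) \<in> fmeasurable lborel"
      using sd by (intro fmeasurable.finite_UN) auto
  qed
  also have "\<dots> \<le> (\<Sum>k\<le>n. measure lborel (sym_diff (F k) (G k)))"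
    using sd by (intro measure_UNION_le fmeasurableD) auto
  also have "\<dots> = partial_sum_dist n (fibre_measures f) (fibre_measures g)"
    unfolding partial_sum_dist_def
  proof (rule sum.cong[OF refl])
    fix k assume "k \<in> {..n}"
    then have "measure lborel (F k) = (\<Sum>i<k. fibre_measures f i)"
        "measure lborel (G k) = (\<Sum>i<k. fibre_measures g i)"
      using measure_initial_segment assms by (auto simp: F_def G_def)
    then show "measure lborel (sym_diff (F k) (G k)) =
        \<bar>(\<Sum>i<k. fibre_measures f i) - (\<Sum>i<k. fibre_measures g i)\<bar>"
      using measure_sym_diff_nested[OF fm nested] by metis
  qed
  finally show ?thesis .
qed

section \<open>Surjectivity: a step map with prescribed fibre lengths\<close>

lemma fibre_measures_surj:
  assumes "x \<in> standard_simplex n"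
  obtains f where "f \<in> usc_maps {..n}" "fibre_measures f = x"
proof -
  have nn: "0 \<le> x i" and z: "i > n \<Longrightarrow> x i = 0" for i
    using assms by (auto simp: standard_simplex_def)
  have s1: "(\<Sum>i\<le>n. x i) = 1" using assms by (simp add: standard_simplex_def)
  \<comment> \<open>\<open>a k\<close> is the intended left endpoint of the fibre over
    \<open>k\<close>. If \<open>x k = 0\<close>, then \<open>a k = a (Suc k)\<close>, and the
    maximum taken in \<open>f\<close> skips \<open>k\<close> when \<open>k < n\<close>.\<close>
  define a where "a = (\<lambda>k. \<Sum>i<k. x i)"
  have a0: "a 0 = 0" and aS: "a (Suc k) = a k + x k" for k by (auto simp: a_def)
  have an: "a (Suc n) = 1" using s1 by (simp add: a_def lessThan_Suc_atMost)
  have am: "a j \<le> a k" if "j \<le> k" for j k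
    unfolding a_def using that nn by (intro sum_mono2) auto
  define S where "S = (\<lambda>t. {k. k \<le> n \<and> a k \<le> t})"
  define f where "f = (\<lambda>t\<in>{0..1}. Max (S t))"
  have fS: "finite (S t)" for t by (simp add: S_def)
  have S0: "S t \<noteq> {}" if "t \<in> {0..1}" for t
    using that a0 by (auto simp: S_def intro!: exI[of _ 0])
  \<comment> \<open>This describes \<open>f\<close> by its superlevel sets; monotonicity, closedness
    and the shape of the fibres are all read off from it.\<close>
  have le_iff: "p \<le> f t \<longleftrightarrow> p \<le> n \<and> a p \<le> t" if "t \<in> {0..1}" for p t
  proof -
    have "p \<le> f t \<longleftrightarrow> (\<exists>k\<in>S t. p \<le> k)"
      using that Max_ge_iff[OF fS S0[OF that]] by (simp add: f_def)
    also have "\<dots> \<longleftrightarrow> p \<le> n \<and> a p \<le> t"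
      \<comment> \<open>As \<open>a\<close> is monotone, \<open>S t\<close> is closed downwards, so
        a member above \<open>p\<close> puts \<open>p\<close> itself into
        \<open>S t\<close>.\<close>
      using am[of p] by (force simp: S_def)
    finally show ?thesis .
  qed
  have "f \<in> {0..1} \<rightarrow>\<^sub>E {..n}"
  proof (rule PiE_I)
    show "f t \<in> {..n}" if "t \<in> {0..1}" for t using le_iff[OF that, of "f t"] by simp
  qed (auto simp: f_def)
  moreover have "mono_on {0..1} f"
  proof (rule mono_onI)
    fix r s :: real assume rs: "r \<in> {0..1}" "s \<in> {0..1}" "r \<le> s"
    then show "f r \<le> f s" using le_iff[of s "f r"] le_iff[of r "f r"] by auto
  qed
  moreover have "closed {t \<in> {0..1}. p \<le> f t}" for p
  proof -
    have "{t \<in> {0..1}. p \<le> f t} = (if p \<le> n then {0..1} \<inter> {a p..} else {})"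
      using le_iff by auto
    then show ?thesis by auto
  qed
  ultimately have f: "f \<in> usc_maps {..n}" by (simp add: usc_maps_def)
  have "fibre_measures f i = x i" for i
  proof (cases "i \<le> n")
    case True
    have eq_iff: "f t = i \<longleftrightarrow> a i \<le> t \<and> (i < n \<longrightarrow> t < a (Suc i))" if "t \<in> {0..1}" for t
      using le_iff[OF that, of i] le_iff[OF that, of "Suc i"] True by auto
    have bds: "0 \<le> a i" "a i \<le> a (Suc i)" "a (Suc i) \<le> 1"
      using am[of 0 i] a0 am[of i "Suc i"] am[of "Suc i" "Suc n"] an True by auto
    \<comment> \<open>Fibres are half-open, except that the last one also contains its right
      endpoint 1; the lengths are the same in both cases.\<close>
    have "f -` {i} \<inter> {0..1} = (if i < n then {a i..<a (Suc i)} else {a i..a (Suc i)})"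
    proof (rule Set.set_eqI)
      have "a (Suc i) = 1" if "\<not> i < n" using that an True by (simp add: le_less)
      then show "t \<in> f -` {i} \<inter> {0..1} \<longleftrightarrow>
          t \<in> (if i < n then {a i..<a (Suc i)} else {a i..a (Suc i)})" for t
        using eq_iff[of t] bds by (cases "t \<in> {0..1}") auto
    qed
    then show ?thesis using bds by (simp add: fibre_measures_def aS)
  next
    case False
    then show ?thesis
      using z[of i] fibre_measures_in_simplex[OF f] by (simp add: standard_simplex_def)
  qed
  then show ?thesis using that f by blast
qed

section \<open>The comparison map on classes is a homeomorphism\<close>

lemma comparison_map_image:
  "comparison_map ` realization {..n} = standard_simplex n"
proof (intro Set.set_eqI iffI)
  fix y assume "y \<in> comparison_map ` realization {..n}"
  then show "y \<in> standard_simplex n"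
    by (auto elim!: realizationE simp: comparison_map_class fibre_measures_in_simplex)
next
  fix y assume "y \<in> standard_simplex n"
  then obtain f where "f \<in> usc_maps {..n}" "fibre_measures f = y" by (rule fibre_measures_surj)
  then show "y \<in> comparison_map ` realization {..n}"
    by (intro image_eqI[of _ _ "usc_maps_rel {..n} `` {f}"])
       (auto simp: comparison_map_class realization_def quotientI)
qed

lemma comparison_map_Lipschitz:
  assumes "x \<in> realization {..n}" "y \<in> realization {..n}"
  shows "\<bar>comparison_map x i - comparison_map y i\<bar> \<le> realization_dist x y"
  using assms
  by (auto elim!: realizationE
      simp: comparison_map_class realization_dist_class fibre_measures_Lipschitz)

lemma realization_dist_le_partial_sum_dist:
  assumes "x \<in> realization {..n}" "y \<in> realization {..n}"
  shows "realization_dist x y \<le> partial_sum_dist n (comparison_map x) (comparison_map y)"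
  using assms
  by (auto elim!: realizationE
      simp: comparison_map_class realization_dist_class maps_dist_le_partial_sum_dist)

text \<open>Equal images make the partial sum bound vanish, and classes at distance 0
  coincide.\<close>

lemma inj_on_comparison_map:
  "inj_on comparison_map (realization {..n})"
proof (rule inj_onI)
  fix x y assume xy: "x \<in> realization {..n}" "y \<in> realization {..n}"
    and eq: "comparison_map x = comparison_map y"
  interpret Metric_space "realization {..n}" realization_dist
    by (simp add: Metric_space_realization)
  have "realization_dist x y \<le> 0"
    using realization_dist_le_partial_sum_dist[OF xy] eq by (simp add: partial_sum_dist_def)
  then show "x = y" using xy nonneg[of x y] zero by simp
qed

text \<open>The simplex carries a subspace topology of the product topology, so continuity may be
  checked in each coordinate.\<close>

lemma continuous_map_comparison_map:
  "continuous_map (realization_topology {..n}) (simplex_topology n) comparison_map"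
proof -
  interpret Metric_space "realization {..n}" realization_dist
    by (simp add: Metric_space_realization)
  have "continuous_map mtopology euclideanreal (\<lambda>x. comparison_map x i)" for i
    unfolding mtopology_is_euclidean[symmetric]
  proof (subst Met_TC.continuous_map_to_metric, intro ballI allI impI)
    fix x and \<epsilon> :: real assume x: "x \<in> topspace mtopology" and "\<epsilon> > 0"
    then show "\<exists>U. openin mtopology U \<and> x \<in> U \<and>
        (\<forall>y\<in>U. comparison_map y i \<in> Met_TC.mball (comparison_map x i) \<epsilon>)"
      using comparison_map_Lipschitz[of x n _ i]
      \<comment> \<open>The same radius works because each coordinate is 1-Lipschitz.\<close>
      by (intro exI[of _ "mball x \<epsilon>"]) (force simp: dist_real_def)
  qed
  moreover have "comparison_map x \<in> standard_simplex n" if "x \<in> realization {..n}" for x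
    using that comparison_map_image by blast
  ultimately show ?thesis
    unfolding realization_topology_def simplex_topology_def Euclidean_space_def
    by (auto simp: continuous_map_in_subtopology continuous_map_componentwise_UNIV
        standard_simplex_def)
qed

text \<open>Makes the sublevel sets of the bound open in the simplex, as the continuity of the
  inverse requires.\<close>

lemma continuous_map_partial_sum_dist:
  "continuous_map (simplex_topology n) euclideanreal (partial_sum_dist n x)"
proof -
  have "continuous_map (simplex_topology n) euclideanreal (\<lambda>y. y i)" for i
    unfolding simplex_topology_def Euclidean_space_def
    by (intro continuous_map_from_subtopology continuous_map_product_projection) simp
  then show ?thesis
    unfolding partial_sum_dist_def
    by (intro continuous_map_sum continuous_map_real_abs continuous_map_diff) auto
qed

lemma homeomorphic_map_comparison_map:
  "homeomorphic_map (realization_topology {..n}) (simplex_topology n) comparison_map"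
proof -
  let ?R = "realization {..n :: nat}" and ?g = "inv_into (realization {..n}) comparison_map"
  interpret Metric_space ?R realization_dist
    by (simp add: Metric_space_realization)
  have g: "?g y \<in> ?R" "comparison_map (?g y) = y" if "y \<in> standard_simplex n" for y
    using that comparison_map_image[of n] by (auto intro: inv_into_into f_inv_into_f)
  have "continuous_map (simplex_topology n) mtopology ?g"
  proof (subst continuous_map_to_metric, intro ballI allI impI)
    fix x and \<epsilon> :: real assume x: "x \<in> topspace (simplex_topology n)" and e: "\<epsilon> > 0"
    \<comment> \<open>An open neighbourhood of \<open>x\<close>, since the bound is continuous and
      vanishes at \<open>x\<close>. The inverse sends it into the ball because the bound dominates
      \<open>realization_dist\<close>.\<close>
    define U where "U = {y \<in> topspace (simplex_topology n). partial_sum_dist n x y \<in> {..<\<epsilon>}}"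
    have "openin (simplex_topology n) U" unfolding U_def
      by (rule openin_continuous_map_preimage[OF continuous_map_partial_sum_dist]) simp
    moreover have "x \<in> U" using x e by (simp add: U_def partial_sum_dist_def)
    moreover have "?g y \<in> mball (?g x) \<epsilon>" if "y \<in> U" for y
      using that x g[of x] g[of y] realization_dist_le_partial_sum_dist[of "?g x" n "?g y"]
      by (auto simp: U_def topspace_simplex_topology)
    ultimately show "\<exists>U. openin (simplex_topology n) U \<and> x \<in> U \<and> (\<forall>y\<in>U. ?g y \<in> mball (?g x) \<epsilon>)"
      by blast
  qed
  then have "homeomorphic_maps (realization_topology {..n}) (simplex_topology n) comparison_map ?g"
    unfolding homeomorphic_maps_def
    using continuous_map_comparison_map[of n] g(2) inj_on_comparison_map[of n]
    by (auto simp: realization_topology_def topspace_simplex_topology)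
  then show ?thesis by (auto simp: homeomorphic_map_maps)
qed

text \<open>On a representative the induced map is composition with \<open>\<theta>\<close>, which
  reduces the claim to \<open>fibre_measures_compose\<close>.\<close>

lemma comparison_map_natural:
  assumes "\<theta> \<in> {..n} \<rightarrow> {..m}" "mono_on {..n} \<theta>" "x \<in> realization {..n}"
  shows "comparison_map (realization_map {..m} \<theta> x) = std_simplex_map n \<theta> (comparison_map x)"
proof -
  obtain f where f: "f \<in> usc_maps {..n}" "x = usc_maps_rel {..n} `` {f}"
    using assms(3) by (rule realizationE)
  then show ?thesis
    using compose_usc_maps[OF _ f(1) assms(1,2)]
    by (simp add: realization_map_class[OF _ _ assms(1,2)] comparison_map_class
        fibre_measures_compose)
qed

theorem lemma3p4:
  fixes n :: nat
  shows "homeomorphic_map (realization_topology {..n}) (simplex_topology n) comparison_map \<and>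
    (\<forall>f \<in> usc_maps {..n}.
       comparison_map (usc_maps_rel {..n} `` {f}) = (\<lambda>i. measure lborel (f -` {i} \<inter> {0..1}))) \<and>
    (\<forall>(m::nat) \<theta>. \<theta> \<in> {..n} \<rightarrow> {..m} \<and> mono_on {..n} \<theta> \<longrightarrow>
       (\<forall>x \<in> realization {..n}.
          comparison_map (realization_map {..m} \<theta> x) = std_simplex_map n \<theta> (comparison_map x)))"
  using homeomorphic_map_comparison_map comparison_map_natural
  \<comment> \<open>Folding \<open>fibre_measures_def\<close> turns the explicit measures of the
    statement into the form given by \<open>comparison_map_class\<close>.\<close>
  by (simp add: comparison_map_class flip: fibre_measures_def)

end
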